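(* Fix integers $n\ge0$ and $i\ge0$. Consider the left half of row $i$ of the difference table, i.e. the entries $F'(i-y,y)$ for integers $y$ with $y<i-y$, read from left to right (in order of increasing $y$, starting from $y\to-\infty$). These entries first weakly increase and then weakly decrease: there exists an integer $m$ such that $F'(i-y,y)$ is weakly increasing in $y$ for $y\le m$ and weakly decreasing in $y$ for $m\le y<i/2$.
   Context: For a fixed integer $n\ge0$, define $F:\mathbb{Z}^2\to\mathbb{Z}_{\ge0}$ by $F(0,0)=2^n$, $F(x,y)=\lfloor F(x-1,y)/2\rfloor+\lfloor F(x,y-1)/2\rfloor$ for every $(x,y)\in\mathbb{Z}_{\ge0}^2\setminus\{(0,0)\}$, and $F(x,y)=0$ for $(x,y)$ outside the first quadrant (the intermediate firing configuration of chip-firing on the quadrant lattice graph started with $2^n$ chips at the origin). The difference table is $F'(x,y)=F(x-1,y)-F(x,y-1)$ for $(x,y)\in\mathbb{Z}^2$; row $i$ of the difference table consists of the entries $F'(x,y)$ with $x+y=i$, ordered left to right by increasing $y$. *)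

theory Defs
  imports Main
begin

function firing :: "nat \<Rightarrow> int \<Rightarrow> int \<Rightarrow> nat" where
  "firing n x y =
    (if x < 0 \<or> y < 0 then 0
     else if x = 0 \<and> y = 0 then 2 ^ n
     else firing n (x - 1) y div 2 + firing n x (y - 1) div 2)"
  by pat_completeness auto
termination
  by (relation "measure (\<lambda>(n, x, y). nat (x + 1) + nat (y + 1))") auto

text \<open>The defining equation loops as an unconditional rewrite rule.\<close>
declare firing.simps [simp del]

definition diff_table :: "nat \<Rightarrow> int \<Rightarrow> int \<Rightarrow> int" where
  "diff_table n x y = int (firing n (x - 1) y) - int (firing n x (y - 1))"

end

theory Submission
  imports Defs
begin

text \<open>
  Write \<open>a\<close> for the antidiagonal \<open>x + y = i - 1\<close> of the firing table, so that row \<open>i\<close> of the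
  difference table is \<open>d y = a y - a (y - 1)\<close>. With \<open>e y = a y div 2 - a (y - 1) div 2\<close>, the next row
  \<open>d'\<close> satisfies \<open>d' (y + 1) - d' y = e (y + 1) - e (y - 1)\<close>. Halving can reverse the order of
  \<open>d (y - 1)\<close> and \<open>d (y + 1)\<close> only if they are equal and odd, and if moreover \<open>d y\<close> lies between
  them, the parities of \<open>a\<close> alternate and \<open>e (y - 1) = e (y + 1)\<close>. So away from the peak, \<open>d'\<close>
  rises and falls as \<open>d\<close> does, and at the peak \<open>m\<close> of \<open>d\<close> the single comparison of \<open>d' m\<close> with
  \<open>d' (m + 1)\<close> may go either way. Across the centre the symmetry of the table supplies the
  missing comparison.
\<close>

definition firing_row :: "nat \<Rightarrow> int \<Rightarrow> int \<Rightarrow> int" where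
  "firing_row n k y = int (firing n (k - y) y)"

lemma diff_table_eq_firing_row:
  "diff_table n (i - y) y = firing_row n (i - 1) y - firing_row n (i - 1) (y - 1)"
  by (simp add: diff_table_def firing_row_def algebra_simps)

lemma firing_outside: "x < 0 \<or> y < 0 \<Longrightarrow> firing n x y = 0"
  by (subst firing.simps) simp

lemma firing_commute: "firing n x y = firing n y x"
proof (induction n x y rule: firing.induct)
  case (1 n x y)
  show ?case
  proof (cases "x < 0 \<or> y < 0 \<or> x = 0 \<and> y = 0")
    case True
    then show ?thesis by (auto simp: firing.simps[of n x y] firing.simps[of n y x])
  next
    case False
    with 1 have "firing n (x - 1) y = firing n y (x - 1)" "firing n x (y - 1) = firing n (y - 1) x"
      by auto
    with False show ?thesis
      by (subst (1 2) firing.simps) auto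
  qed
qed

lemma firing_row_reflect: "firing_row n k (k - y) = firing_row n k y"
  by (simp add: firing_row_def firing_commute)

lemma firing_row_negative: "k < 0 \<Longrightarrow> firing_row n k y = 0"
  unfolding firing_row_def by (subst firing_outside) auto

lemma firing_row_0: "firing_row n 0 y = (if y = 0 then 2 ^ n else 0)"
  unfolding firing_row_def by (subst firing.simps) auto

text \<open>For \<open>k = -1\<close> the recursion fails: row 0 receives its \<open>2 ^ n\<close>
  at the origin from no earlier row.\<close>

lemma firing_row_Suc:
  assumes "k \<ge> 0"
  shows "firing_row n (k + 1) y = firing_row n k y div 2 + firing_row n k (y - 1) div 2"
proof (cases "y < 0 \<or> k + 1 - y < 0")
  case True
  then show ?thesis
    by (auto simp: firing_row_def firing_outside)
next
  case False
  then have "firing n (k + 1 - y) y = firing n (k - y) y div 2 + firing n (k + 1 - y) (y - 1) div 2"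
    using assms by (subst firing.simps) auto
  then show ?thesis
    by (simp add: firing_row_def zdiv_int algebra_simps)
qed

text \<open>Equal odd outer differences may halve differently:
  \<open>a, b, c, d = 1, 2, 2, 3\<close> gives 1 and 0. The middle difference excludes this: it must
  equal them, so \<open>c - a\<close> is even.\<close>

lemma half_diff_mono:
  fixes a b c d :: int
  assumes "b - a \<le> c - b" "c - b \<le> d - c"
  shows "b div 2 - a div 2 \<le> d div 2 - c div 2"
  using assms by presburger

lemma half_diff_antimono:
  fixes a b c d :: int
  assumes "c - b \<le> b - a" "d - c \<le> c - b"
  shows "d div 2 - c div 2 \<le> b div 2 - a div 2"
  using assms by presburger

text \<open>In the recursion the halved entry at \<open>y - 1\<close> is common to both sides,
  leaving \<open>y - 2\<close> against \<open>y\<close> in the previous row. For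
  \<open>2 * y = k + 2\<close> these are mirror images.\<close>

lemma firing_row_left_mono:
  "2 * y \<le> int k + 1 \<Longrightarrow> firing_row n (int k) (y - 1) \<le> firing_row n (int k) y"
proof (induction k arbitrary: y)
  case 0
  then show ?case by (auto simp: firing_row_0)
next
  case (Suc k)
  have rec: "firing_row n (int (Suc k)) z = firing_row n (int k) z div 2 + firing_row n (int k) (z - 1) div 2"
    for z using firing_row_Suc[of "int k" n z] by (simp add: add.commute)
  have below: "firing_row n (int k) (y - 2) \<le> firing_row n (int k) (y - 1)"
    using Suc.IH[of "y - 1"] Suc.prems by simp
  have "firing_row n (int k) (y - 2) \<le> firing_row n (int k) y"
  proof (cases "2 * y \<le> int k + 1")
    case True
    with below Suc.IH[of y] show ?thesis by simp
  next
    case False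
    with Suc.prems have "y = int k - (y - 2)" by simp
    with firing_row_reflect[of n "int k" "y - 2"] show ?thesis by simp
  qed
  then show ?case unfolding rec by (simp add: zdiv_mono1)
qed

text \<open>The descent is followed up to the centre \<open>2 * (y + 1) = k + 1\<close>, one entry
  past the left half, because \<open>dec'\<close> uses that comparison in the induction
  step.\<close>

lemma firing_row_diff_unimodal:
  fixes n k :: nat
  defines "d \<equiv> \<lambda>k y. firing_row n (int k) y - firing_row n (int k) (y - 1)"
  shows "\<exists>m. (\<forall>y<m. d k y \<le> d k (y + 1)) \<and>
             (\<forall>y\<ge>m. 2 * (y + 1) \<le> int k + 1 \<longrightarrow> d k (y + 1) \<le> d k y)"
proof (induction k)
  case 0
  show ?case
    \<comment> \<open>The entries are \<open>2 ^ n\<close> at 0, its negative at 1, and zero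
      elsewhere. For \<open>m = 0\<close> the descending range is empty.\<close>
    by (rule exI[of _ 0]) (auto simp: d_def firing_row_0)
next
  case (Suc k)
  define a where "a = firing_row n (int k)"
  define e where "e y = a y div 2 - a (y - 1) div 2" for y
  have step: "d (Suc k) (y + 1) - d (Suc k) y = e (y + 1) - e (y - 1)" for y
    using firing_row_Suc[of "int k" n]
    by (simp add: d_def e_def a_def add.commute)
  obtain m where
    inc: "\<And>y. y < m \<Longrightarrow> d k y \<le> d k (y + 1)" and
    dec: "\<And>y. y \<ge> m \<Longrightarrow> 2 * (y + 1) \<le> int k + 1 \<Longrightarrow> d k (y + 1) \<le> d k y"
    using Suc.IH by blast
  have inc': "e (y - 1) \<le> e (y + 1)" if "y < m" for y
    using half_diff_mono[of "a (y - 1)" "a (y - 2)" "a y" "a (y + 1)"] inc[of "y - 1"] inc[of y] that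
    by (simp add: d_def e_def a_def)
  have e_nonneg: "0 \<le> e y" if "2 * y \<le> int k + 1" for y
    using firing_row_left_mono[OF that] by (simp add: e_def a_def zdiv_mono1)
  have dec': "e (y + 1) \<le> e (y - 1)" if "m < y" "2 * (y + 1) \<le> int k + 2" for y
  proof (cases "2 * (y + 1) \<le> int k + 1")
    case True
    then show ?thesis
      using half_diff_antimono[of "a y" "a (y - 1)" "a (y - 2)" "a (y + 1)"] dec[of "y - 1"] dec[of y] that
      by (simp add: d_def e_def a_def)
  next
    case False
    \<comment> \<open>Now \<open>y\<close> is the centre of the firing row, and reflection gives
      \<open>e (y + 1) = - e y \<le> 0 \<le> e (y - 1)\<close>.\<close>
    with that have k: "int k = 2 * y" by simp
    then have "a (y + 1) = a (y - 1)"
      using firing_row_reflect[of n "int k" "y - 1"] by (simp add: a_def)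
    then have "e (y + 1) = - e y" by (simp add: e_def)
    with e_nonneg[of y] e_nonneg[of "y - 1"] k show ?thesis by simp
  qed
  show ?case
  \<comment> \<open>This sign decides whether the peak moves to \<open>m + 1\<close> or stays at
    \<open>m\<close>.\<close>
  proof (cases "e (m - 1) \<le> e (m + 1)")
    case True
    have "d (Suc k) y \<le> d (Suc k) (y + 1)" if "y < m + 1" for y
      using True inc'[of y] step[of y] that by (cases "y = m") auto
    moreover have "d (Suc k) (y + 1) \<le> d (Suc k) y"
      if "y \<ge> m + 1" "2 * (y + 1) \<le> int (Suc k) + 1" for y
      using dec'[of y] step[of y] that by auto
    ultimately show ?thesis by blast
  next
    case False
    have "d (Suc k) y \<le> d (Suc k) (y + 1)" if "y < m" for y
      using inc'[of y] step[of y] that by auto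
    moreover have "d (Suc k) (y + 1) \<le> d (Suc k) y"
      if "y \<ge> m" "2 * (y + 1) \<le> int (Suc k) + 1" for y
      using False dec'[of y] step[of y] that by (cases "y = m") auto
    ultimately show ?thesis by blast
  qed
qed

lemma int_steps_imp_le:
  fixes f :: "int \<Rightarrow> 'a :: preorder"
  assumes "x \<le> y" "\<And>z. x \<le> z \<Longrightarrow> z < y \<Longrightarrow> f z \<le> f (z + 1)"
  shows "f x \<le> f y"
  using assms
proof (induction y rule: int_ge_induct)
  case (step i)
  have "f x \<le> f i" using step.IH step.prems by simp
  also have "f i \<le> f (i + 1)" using step.prems step.hyps by simp
  finally show ?case .
qed simp

lemma int_steps_imp_ge:
  fixes f :: "int \<Rightarrow> int"
  assumes "x \<le> y" "\<And>z. x \<le> z \<Longrightarrow> z < y \<Longrightarrow> f (z + 1) \<le> f z"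
  shows "f y \<le> f x"
  using int_steps_imp_le[of x y "\<lambda>z. - f z"] assms by simp

theorem theorem9p8:
  fixes n :: nat and i :: int
  assumes "i \<ge> 0"
  shows "\<exists>m::int.
    mono_on {y. y \<le> m} (\<lambda>y. diff_table n (i - y) y) \<and>
    antimono_on {y. m \<le> y \<and> y < i - y} (\<lambda>y. diff_table n (i - y) y)"
proof (cases "i = 0")
  case True
  \<comment> \<open>Row 0 is the difference of the zero firing row -1. Rewriting with
    \<open>diff_0\<close> would turn \<open>0 - y\<close> into \<open>- y\<close> and hide the
    pattern of \<open>diff_table_eq_firing_row\<close>.\<close>
  then show ?thesis
    by (intro exI[of _ 0])
      (simp add: diff_table_eq_firing_row firing_row_negative monotone_on_def del: diff_0)
next
  case False
  with assms have i: "int (nat (i - 1)) + 1 = i" by simp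
  define d where "d y = diff_table n (i - y) y" for y
  have d_eq: "d y = firing_row n (int (nat (i - 1))) y - firing_row n (int (nat (i - 1))) (y - 1)" for y
    using assms False by (simp add: d_def diff_table_eq_firing_row)
  have "\<exists>m. (\<forall>y<m. d y \<le> d (y + 1)) \<and> (\<forall>y\<ge>m. 2 * (y + 1) \<le> i \<longrightarrow> d (y + 1) \<le> d y)"
    using firing_row_diff_unimodal[of n "nat (i - 1)"] unfolding d_eq i .
  then obtain m where
    inc: "\<And>y. y < m \<Longrightarrow> d y \<le> d (y + 1)" and
    dec: "\<And>y. y \<ge> m \<Longrightarrow> 2 * (y + 1) \<le> i \<Longrightarrow> d (y + 1) \<le> d y"
    by blast
  have "mono_on {y. y \<le> m} d"
    by (rule monotone_onI, rule int_steps_imp_le[where f = d]) (simp_all add: inc)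
  moreover have "antimono_on {y. m \<le> y \<and> y < i - y} d"
    by (rule monotone_onI, rule int_steps_imp_ge[where f = d]) (simp_all add: dec)
  ultimately show ?thesis unfolding d_def by blast
qed

end
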